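(* Let $H_k := 1 + \frac{1}{2} + \cdots + \frac{1}{k}$ denote the $k$th harmonic number and let $\zeta(s)=\sum_{k=1}^\infty k^{-s}$ ($\Re(s)>1$) be the Riemann zeta function. Then $$\sum_{k=1}^\infty \frac{H_k H_{k+1} H_{k+2} H_{k+3}}{k(k+1)(k+2)(k+3)} = -\frac{4}{9} \zeta (2)-\frac{1}{6}\zeta (2) \zeta (3)-\frac{7}{24} \zeta (3)+\frac{191}{144} \zeta (4)+\frac{1}{2}\zeta (5).$$
   Context: $H_k := \sum_{j=1}^k \frac1j$ for integers $k\ge 1$; $\zeta$ is the Riemann zeta function. *)

theory Defs
  imports "HOL-Analysis.Analysis"
begin

(* Only meaningful on the half-plane Re s > 1, where the series converges;
   no analytic continuation is built in. *)
definition zeta :: "complex \<Rightarrow> complex" where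
  "zeta s = (\<Sum>n. of_nat (Suc n) powr (- s))"

end

theory Submission
  imports Defs "HOL-Real_Asymp.Real_Asymp"
begin

text \<open>
  Write $h = H_k$. Partial fractions and the shifts $H_{k+1} = H_k + 1/(k+1)$ turn the summand into
  a telescoping difference plus a combination of $h^2/k^2$, $h/k^2$, $h/k^3$, $h/k^4$ and pure
  powers of $1/k$; all other terms $h^d/k^e$ cancel.

  The remaining Euler sums come from $H_n/n = \sum_m 1/(m(m+n))$. This makes $\sum_n H_n/n^q$ a double
  series in $m, n \ge 1$, which is summed along $m + n = s$ after repeated use of
  $1/(mn) = (1/m + 1/n)/s$. The result is a linear relation between the sums
  $\sum_s H^{(p)}_{s-1}/s^q$; together with the product formula for $\zeta(p)\zeta(q)$ and, in weight
  four, the Cauchy product for $\zeta(2)^2$, these relations determine all linear sums needed. The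
  same rearrangement of $\sum_n H_n \cdot H_n/n^2$ yields the quadratic sum.
\<close>

section \<open>Generalized harmonic numbers and real zeta values\<close>

text \<open>Indexed so that in products with \<open>1 / real (Suc n) ^ q\<close> the inner index
  stays strictly below the outer one.\<close>

definition gharm :: "nat \<Rightarrow> nat \<Rightarrow> real" where
  "gharm p n = (\<Sum>k<n. 1 / real (Suc k) ^ p)"

text \<open>A real-valued zeta, since the rearrangements rest on nonnegativity;
  \<open>zeta_of_nat\<close> links it to \<open>zeta\<close>.\<close>

definition rzeta :: "nat \<Rightarrow> real" where
  "rzeta p = (\<Sum>n. 1 / real (Suc n) ^ p)"

lemma gharm_0 [simp]: "gharm p 0 = 0"
  by (simp add: gharm_def)

lemma gharm_Suc: "gharm p (Suc n) = gharm p n + 1 / real (Suc n) ^ p"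
  by (simp add: gharm_def)

lemma gharm_1: "gharm 1 n = harm n"
  by (simp add: gharm_def harm_altdef field_simps)

lemma rzeta_sums:
  assumes "p \<ge> 2" shows "(\<lambda>n. 1 / real (Suc n) ^ p) sums rzeta p"
proof -
  have "summable (\<lambda>n. inverse (real (Suc n) ^ p))"
    using inverse_power_summable[OF assms, where 'a = real] by (subst summable_Suc_iff)
  then show ?thesis
    by (simp add: rzeta_def summable_sums divide_inverse)
qed

lemma zeta_of_nat:
  assumes "p \<ge> 2" shows "zeta (of_nat p) = of_real (rzeta p)"
proof -
  have "of_nat (Suc n) powr (- of_nat p) = (of_real (1 / real (Suc n) ^ p) :: complex)" for n
    by (simp add: powr_minus powr_nat' divide_inverse del: of_nat_Suc)
  then show ?thesis
    unfolding zeta_def using sums_unique[OF sums_of_real[OF rzeta_sums[OF assms], where 'a = complex]]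
    by (simp add: rzeta_def)
qed

section \<open>Double series and basic series identities\<close>

text \<open>Nonnegativity makes the iterated convergence unconditional, so the pairs may be
  regrouped by \<open>t = i + j\<close>.\<close>

lemma antidiagonal_sums:
  fixes f :: "nat \<Rightarrow> nat \<Rightarrow> real"
  assumes nonneg: "\<And>i j. f i j \<ge> 0"
    and rows: "\<And>j. (\<lambda>i. f i j) sums r j" and total: "r sums S"
  shows "(\<lambda>t. \<Sum>i\<le>t. f i (t - i)) sums S"
proof -
  have r: "((\<lambda>i. f i j) has_sum r j) UNIV" for j
    using rows nonneg by (intro sums_nonneg_imp_has_sum)
  have "r j \<ge> 0" for j
    using nonneg by (rule sums_le[OF _ sums_zero rows])
  then have R: "(r has_sum S) UNIV"
    using total by (intro sums_nonneg_imp_has_sum)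
  have "((\<lambda>(j, i). f i j) has_sum S) (UNIV \<times> UNIV)"
    using r R nonneg
    by (intro has_sum_SigmaI[where g = r] summable_on_SigmaI[where g = r])
       (auto simp: summable_on_def)
  also have "?this \<longleftrightarrow> ((\<lambda>(t, i). f i (t - i)) has_sum S) (Sigma UNIV (\<lambda>t. {..t}))"
    by (rule has_sum_reindex_bij_witness[of _ "\<lambda>(t, i). (t - i, i)" "\<lambda>(j, i). (i + j, i)"]) auto
  finally have "((\<lambda>t. \<Sum>i\<le>t. f i (t - i)) has_sum S) UNIV"
    by (rule has_sum_SigmaD) (auto intro: has_sum_finite)
  then show ?thesis
    by (rule has_sum_imp_sums)
qed

lemma inverse_mult_add:
  fixes a c :: real assumes "a > 0" "c > 0"
  shows "1 / (a * (a + c)) = (1 / a - 1 / (a + c)) / c"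
  using assms by (simp add: divide_simps)

text \<open>This is $1/(ab) = (1/a + 1/b)/(a+b)$ divided by $b^q$; each use lowers the mixed
  exponent by one.\<close>

lemma inverse_mult_power_Suc:
  fixes a b :: real assumes "a > 0" "b > 0"
  shows "1 / (a * b ^ Suc q) = (1 / b ^ Suc q + 1 / (a * b ^ q)) / (a + b)"
  using assms by (simp add: divide_simps add_pos_pos add_nonneg_eq_0_iff)

text \<open>With $m = i+1$ and $n = j+1$, partial fractions give $(1/m - 1/(m+n))/n$, which
  telescopes with gap $n$: the first $n$ terms form $H_n$, and the $n$ trailing ones tend to
  zero.\<close>

lemma harm_row_sums:
  "(\<lambda>i. 1 / (real (Suc i) * real (i + j + 2))) sums (harm (Suc j) / real (Suc j))"
proof -
  have part: "(\<Sum>i<N. 1 / (real (Suc i) * real (i + j + 2))) =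
      (harm (Suc j) - (\<Sum>l\<le>j. 1 / real (N + l + 1))) / real (Suc j)" for N
  proof (induction N)
    case 0
    then show ?case
      by (simp add: harm_altdef lessThan_Suc_atMost[symmetric] field_simps del: sum.lessThan_Suc)
  next
    case (Suc N)
    have "(\<Sum>l\<le>j. 1 / real (N + l + 1)) + 1 / real (N + j + 2) = (\<Sum>l\<le>Suc j. 1 / real (N + l + 1))"
      by simp
    also have "\<dots> = 1 / real (N + 1) + (\<Sum>l\<le>j. 1 / real (Suc N + l + 1))"
      by (subst sum.atMost_Suc_shift) simp
    finally have "(\<Sum>l\<le>j. 1 / real (Suc N + l + 1)) = (\<Sum>l\<le>j. 1 / real (N + l + 1)) + 1 / real (N + j + 2) - 1 / real (N + 1)"
      by linarith
    moreover have "1 / (real (Suc N) * real (N + j + 2)) = (1 / real (N + 1) - 1 / real (N + j + 2)) / real (Suc j)"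
      using inverse_mult_add[of "real (Suc N)" "real (Suc j)"] by (simp add: add_ac)
    ultimately show ?case
      using Suc by (simp add: diff_divide_distrib add_divide_distrib)
  qed
  have "(\<lambda>N. \<Sum>l\<le>j. 1 / real (N + l + 1)) \<longlonglongrightarrow> (\<Sum>l\<le>j. 0)"
    by (intro tendsto_sum) real_asymp
  then have "(\<lambda>N. (harm (Suc j) - (\<Sum>l\<le>j. 1 / real (N + l + 1))) / real (Suc j))
      \<longlonglongrightarrow> (harm (Suc j) - (\<Sum>l\<le>j. 0)) / real (Suc j)"
    by (rule tendsto_divide[OF tendsto_diff[OF tendsto_const] tendsto_const]) simp
  then show ?thesis
    unfolding sums_def part by simp
qed

text \<open>The summand is exactly the increment of \<open>gharm p n * gharm q n\<close>, so the
  partial sums are these products.\<close>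

lemma stuffle_sums:
  assumes "p \<ge> 2" "q \<ge> 2"
  shows "(\<lambda>n. gharm p n / real (Suc n) ^ q + gharm q n / real (Suc n) ^ p + 1 / real (Suc n) ^ (p + q))
     sums (rzeta p * rzeta q)"
proof -
  have part: "(\<Sum>n<N. gharm p n / real (Suc n) ^ q + gharm q n / real (Suc n) ^ p + 1 / real (Suc n) ^ (p + q))
      = gharm p N * gharm q N" for N
    by (induction N) (auto simp: gharm_Suc field_simps power_add simp del: of_nat_Suc)
  have "gharm p \<longlonglongrightarrow> rzeta p" "gharm q \<longlonglongrightarrow> rzeta q"
    using rzeta_sums assms by (auto simp: sums_def gharm_def[abs_def])
  then show ?thesis
    unfolding sums_def part by (rule tendsto_mult)
qed

section \<open>Convolutions of reciprocals\<close>

text \<open>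
  Positive integers are indexed from zero, so \<open>recip_conv q t\<close> sums $1/(m n^q)$ over $m + n = s$ with
  $s = t + 2$, and the matching $H_{s-1}$ is \<open>gharm 1 (Suc t)\<close>.
\<close>
definition recip_conv :: "nat \<Rightarrow> nat \<Rightarrow> real" where
  "recip_conv q t = (\<Sum>i\<le>t. 1 / (real (Suc i) * real (Suc (t - i)) ^ q))"

lemma sum_atMost_rev:
  fixes g :: "nat \<Rightarrow> 'a::comm_monoid_add"
  shows "(\<Sum>i\<le>t. g (t - i)) = (\<Sum>i\<le>t. g i)"
  by (rule sum.nat_diff_reindex[of g "Suc t", simplified lessThan_Suc_atMost, simplified])

lemma recip_conv_0: "recip_conv 0 t = gharm 1 (Suc t)"
  by (simp add: recip_conv_def gharm_def lessThan_Suc_atMost)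

text \<open>On the antidiagonal the two factors add up to \<open>t + 2\<close>, so the denominator
  produced by \<open>inverse_mult_power_Suc\<close> is constant and leaves the sum.\<close>

lemma recip_conv_Suc: "recip_conv (Suc q) t = (gharm (Suc q) (Suc t) + recip_conv q t) / real (t + 2)"
proof -
  have "1 / (real (Suc i) * real (Suc (t - i)) ^ Suc q) =
      (1 / real (Suc (t - i)) ^ Suc q + 1 / (real (Suc i) * real (Suc (t - i)) ^ q)) / real (t + 2)"
    if "i \<le> t" for i
  proof -
    have e: "real (t + 2) = real (Suc i) + real (Suc (t - i))" using that by simp
    have "0 < real (Suc i)" "0 < real (Suc (t - i))" by auto
    then show ?thesis unfolding e by (rule inverse_mult_power_Suc)
  qed
  then have "recip_conv (Suc q) t = (\<Sum>i\<le>t. (1 / real (Suc (t - i)) ^ Suc q + 1 / (real (Suc i) * real (Suc (t - i)) ^ q)) / real (t + 2))"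
    unfolding recip_conv_def by (intro sum.cong) auto
  also have "\<dots> = ((\<Sum>i\<le>t. 1 / real (Suc (t - i)) ^ Suc q) + recip_conv q t) / real (t + 2)"
    by (simp add: recip_conv_def sum_divide_distrib[symmetric] sum.distrib)
  also have "(\<Sum>i\<le>t. 1 / real (Suc (t - i)) ^ Suc q) = gharm (Suc q) (Suc t)"
    using sum_atMost_rev[of "\<lambda>i. 1 / real (Suc i) ^ Suc q" t] by (simp add: gharm_def lessThan_Suc_atMost del: power_Suc of_nat_Suc)
  finally show ?thesis .
qed

lemma recip_conv_1: "recip_conv 1 t = 2 * gharm 1 (Suc t) / real (t + 2)"
  using recip_conv_Suc[of 0 t] by (simp add: recip_conv_0)

text \<open>One factor $H_n/n$ is expanded by \<open>harm_row_sums\<close>; in the regrouped series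
  $m + n$ equals \<open>t + 2\<close>.\<close>

lemma euler_sum_conv:
  assumes "(\<lambda>n. harm (Suc n) / real (Suc n) ^ Suc q) sums S"
  shows "(\<lambda>t. recip_conv q t / real (t + 2)) sums S"
proof -
  let ?f = "\<lambda>i j. 1 / (real (Suc i) * real (i + j + 2)) / real (Suc j) ^ q"
  have "(\<lambda>t. \<Sum>i\<le>t. ?f i (t - i)) sums S"
  proof (rule antidiagonal_sums)
    show "(\<lambda>i. ?f i j) sums (harm (Suc j) / real (Suc j) / real (Suc j) ^ q)" for j
      by (intro sums_divide harm_row_sums)
    show "(\<lambda>j. harm (Suc j) / real (Suc j) / real (Suc j) ^ q) sums S"
      using assms by (simp add: divide_divide_eq_left mult.commute del: of_nat_Suc)
  qed auto
  moreover have "(\<Sum>i\<le>t. ?f i (t - i)) = recip_conv q t / real (t + 2)" for t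
    unfolding recip_conv_def sum_divide_distrib by (intro sum.cong) (auto simp: field_simps)
  ultimately show ?thesis by simp
qed

text \<open>Symmetry under swapping $m$ and $n$ gives the factor 2. The relation later eliminates
  \<open>rzeta 2 * rzeta 2\<close> in favour of \<open>rzeta 4\<close>.\<close>

lemma rzeta_2_squared_conv: "(\<lambda>t. 2 * (recip_conv 2 t / real (t + 2))) sums (rzeta 2 * rzeta 2)"
proof -
  let ?a = "\<lambda>i. 1 / real (Suc i) ^ 2"
  have s: "?a sums rzeta 2" by (rule rzeta_sums) simp
  have "(\<lambda>t. \<Sum>i\<le>t. ?a i * ?a (t - i)) sums (rzeta 2 * rzeta 2)"
    using Cauchy_product_sums[of ?a ?a] s by (simp add: sums_iff)
  moreover have "(\<Sum>i\<le>t. ?a i * ?a (t - i)) = 2 * (recip_conv 2 t / real (t + 2))" for t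
  proof -
    let ?g = "\<lambda>i. 1 / (real (Suc i) * real (Suc (t - i)) ^ 2)"
    have "(\<Sum>i\<le>t. ?a i * ?a (t - i)) = (\<Sum>i\<le>t. (?g i + ?g (t - i)) / real (t + 2))"
    proof (rule sum.cong[OF refl])
      fix i assume "i \<in> {..t}"
      then have e: "real (t + 2) = real (Suc i) + real (Suc (t - i))" "t - (t - i) = i" by simp_all
      have "0 < real (Suc i)" "0 < real (Suc (t - i))" by auto
      then show "?a i * ?a (t - i) = (?g i + ?g (t - i)) / real (t + 2)"
        unfolding e by (simp add: divide_simps del: of_nat_Suc) (simp add: algebra_simps power2_eq_square del: of_nat_Suc)
    qed
    also have "\<dots> = 2 * (recip_conv 2 t / real (t + 2))"
      by (simp only: sum_divide_distrib[symmetric] sum.distrib sum_atMost_rev[of ?g] recip_conv_def) simp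
    finally show ?thesis .
  qed
  ultimately show ?thesis by simp
qed

section \<open>Finite sums for the quadratic Euler sum\<close>

text \<open>The left side sums $1/(ij)$ over $i \<le> j$, which is half of the full square plus half
  of its diagonal.\<close>

lemma sum_harm_div: "(\<Sum>j\<le>t. harm (Suc j) / real (Suc j)) = ((harm (Suc t))\<^sup>2 + gharm 2 (Suc t)) / 2"
proof -
  have "(\<Sum>j<n. harm (Suc j) / real (Suc j)) = ((harm n)\<^sup>2 + gharm 2 n) / 2" for n
  proof (induction n)
    case (Suc n)
    define y where "y = 1 / real (Suc n)"
    have "harm (Suc n) = harm n + y" "gharm 2 (Suc n) = gharm 2 n + y\<^sup>2" "harm (Suc n) / real (Suc n) = harm (Suc n) * y"
      by (simp_all add: y_def harm_Suc gharm_Suc divide_inverse power_inverse)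
    with Suc show ?case
      by (simp add: power2_eq_square algebra_simps)
  qed (simp add: harm_expand)
  from this[of "Suc t"] show ?thesis
    by (simp only: lessThan_Suc_atMost)
qed

text \<open>Raising \<open>t\<close> by one adds \<open>recip_conv 1 (Suc t)\<close>, that is $2
  H_N/(N+1)$ with $N = t+2$; on the right the two squares $1/(N+1)^2$ cancel and leave the same
  increment.\<close>

lemma sum_harm_conv: "(\<Sum>i\<le>t. harm (Suc (t - i)) / real (Suc i)) = (harm (t + 2))\<^sup>2 - gharm 2 (t + 2)"
proof (induction t)
  case 0
  show ?case by (simp add: harm_expand gharm_Suc numeral_2_eq_2 harm_Suc)
next
  case (Suc t)
  have "(\<Sum>i\<le>Suc t. harm (Suc (Suc t - i)) / real (Suc i))
      = (\<Sum>i\<le>Suc t. harm (Suc t - i) / real (Suc i) + 1 / (real (Suc i) * real (Suc (Suc t - i)) ^ 1))"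
    by (intro sum.cong) (auto simp: harm_Suc divide_inverse algebra_simps simp del: of_nat_Suc)
  \<comment> \<open>The term \<open>i = Suc t\<close> of the first sum drops out because
    \<open>harm 0 = 0\<close>.\<close>
  also have "\<dots> = (\<Sum>i\<le>t. harm (Suc (t - i)) / real (Suc i)) + recip_conv 1 (Suc t)"
    unfolding sum.distrib recip_conv_def by (simp add: harm_expand Suc_diff_le)
  also have "\<dots> = (harm (Suc t + 2))\<^sup>2 - gharm 2 (Suc t + 2)"
  proof -
    have "harm (Suc t + 2) = harm (t + 2) + 1 / real (t + 3)" "gharm 2 (Suc t + 2) = gharm 2 (t + 2) + 1 / real (t + 3) ^ 2"
      using harm_Suc[of "t + 2", where 'a = real] gharm_Suc[of 2 "t + 2"] by (simp_all add: divide_inverse add_ac)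
    moreover have "recip_conv 1 (Suc t) = 2 * harm (t + 2) / real (t + 3)"
      unfolding recip_conv_1 gharm_1 by (simp add: add_ac)
    ultimately show ?thesis
      unfolding Suc by (simp add: power2_eq_square algebra_simps)
  qed
  finally show ?case .
qed

section \<open>Growth and convergence\<close>

lemma harm_le_ln: "n > 0 \<Longrightarrow> harm n \<le> ln (real n) + 1"
  using euler_mascheroni_sequence_decreasing[of 1 n] by (simp add: harm_expand)

lemma harm_power4_over_nat_tendsto_0:
  "(\<lambda>n. harm (Suc n) ^ 4 / real (Suc n)) \<longlonglongrightarrow> 0"
proof (rule tendsto_sandwich[of "\<lambda>_. 0"])
  show "(\<lambda>n. (ln (real (Suc n)) + 1) ^ 4 / real (Suc n)) \<longlonglongrightarrow> 0"
    by real_asymp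
  show "\<forall>\<^sub>F n in sequentially. harm (Suc n) ^ 4 / real (Suc n) \<le> (ln (real (Suc n)) + 1) ^ 4 / real (Suc n)"
    by (intro always_eventually allI divide_right_mono power_mono harm_le_ln harm_nonneg) auto
qed (auto simp: harm_nonneg)

lemma summable_harm_squared: "summable (\<lambda>n. (harm (Suc n))\<^sup>2 / (real (Suc n))\<^sup>2)"
proof (rule summable_comparison_test_bigo)
  \<comment> \<open>Any exponent strictly between -2 and -1 absorbs the squared logarithm and
    remains summable.\<close>
  show "summable (\<lambda>n. norm (real n powr (-3/2)))"
    by (simp add: summable_real_powr_iff)
  have "(\<lambda>n. (harm (Suc n))\<^sup>2 / (real (Suc n))\<^sup>2) \<in> O(\<lambda>n. (ln (real (Suc n)) + 1)\<^sup>2 / (real (Suc n))\<^sup>2)"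
    by (intro landau_o.big_mono always_eventually allI)
       (simp add: divide_right_mono power_mono harm_le_ln harm_nonneg del: of_nat_Suc)
  also have "(\<lambda>n. (ln (real (Suc n)) + 1)\<^sup>2 / (real (Suc n))\<^sup>2) \<in> O(\<lambda>n. real n powr (-3/2))"
    by real_asymp
  finally show "(\<lambda>n. (harm (Suc n))\<^sup>2 / (real (Suc n))\<^sup>2) \<in> O(\<lambda>n. real n powr (-3/2))" .
qed

lemma harm_Suc_ge_1: "harm (Suc n) \<ge> (1 :: real)"
  using harm_mono[of 1 "Suc n", where 'a = real] by (simp add: harm_expand)

text \<open>Convergence must be known before the linear relations can be solved for the
  sums.\<close>

lemma summable_euler_sum:
  assumes "q \<ge> 2" shows "summable (\<lambda>n. harm (Suc n) / real (Suc n) ^ q)"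
proof (rule summable_comparison_test'[OF summable_harm_squared])
  fix n
  have "harm (Suc n) \<le> (harm (Suc n) :: real) ^ 2"
    using harm_Suc_ge_1 by (intro self_le_power) auto
  moreover have "real (Suc n) ^ 2 \<le> real (Suc n) ^ q"
    using assms by (intro power_increasing) auto
  ultimately show "norm (harm (Suc n) / real (Suc n) ^ q) \<le> (harm (Suc n))\<^sup>2 / (real (Suc n))\<^sup>2"
    by (simp add: harm_nonneg frac_le del: of_nat_Suc)
qed

section \<open>Linear Euler sums\<close>

text \<open>Antidiagonals start at $s = 2$; the missing term $s = 1$ has an empty harmonic
  factor.\<close>

lemma sums_shift_zero:
  fixes f :: "nat \<Rightarrow> 'a::real_normed_vector"
  assumes "(\<lambda>n. f (Suc n)) sums S" "f 0 = 0" shows "f sums S"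
  using assms by (simp add: sums_Suc_iff)

text \<open>Removing the diagonal $1/n^{q+1}$ passes from inner indices up to $n$ to those strictly
  below.\<close>

lemma euler_sum_shift:
  assumes "q \<ge> 1" "(\<lambda>n. harm (Suc n) / real (Suc n) ^ q) sums S"
  shows "(\<lambda>n. gharm 1 n / real (Suc n) ^ q) sums (S - rzeta (Suc q))"
proof -
  have "(\<lambda>n. harm (Suc n) / real (Suc n) ^ q - 1 / real (Suc n) ^ Suc q) sums (S - rzeta (Suc q))"
    using assms by (intro sums_diff rzeta_sums) auto
  then show ?thesis
    by (simp add: gharm_1[simplified] harm_Suc divide_inverse algebra_simps del: of_nat_Suc)
qed

text \<open>Regrouping reproduces twice the strict version of the same sum, so $S = 2(S -
  \<zeta>(3))$.\<close>

lemma euler_sum_2: "(\<lambda>n. harm (Suc n) / real (Suc n) ^ 2) sums (2 * rzeta 3)"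
proof -
  obtain S where S: "(\<lambda>n. harm (Suc n) / real (Suc n) ^ 2) sums S"
    using summable_euler_sum[of 2] by (auto simp: summable_def)
  have "(\<lambda>n. 2 * (gharm 1 n / real (Suc n) ^ 2)) sums S"
    using euler_sum_conv[of 1 S] S
    by - (rule sums_shift_zero,
       simp_all add: recip_conv_1[simplified] numeral_2_eq_2 add_ac)
  then have "S = 2 * (S - rzeta 3)"
    using euler_sum_shift[OF _ S] by (metis Suc_1 one_le_numeral eval_nat_numeral(3) sums_mult sums_unique2)
  then show ?thesis using S by simp
qed

lemma recip_conv_2: "recip_conv 2 t / real (t + 2) = gharm 2 (Suc t) / real (t + 2) ^ 2 + 2 * (gharm 1 (Suc t) / real (t + 2) ^ 3)"
  unfolding recip_conv_Suc[of 1 t, unfolded Suc_1] recip_conv_1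
  by (simp add: add_divide_distrib power2_eq_square power3_eq_cube)

lemma recip_conv_3: "recip_conv 3 t / real (t + 2) = gharm 3 (Suc t) / real (t + 2) ^ 2 + gharm 2 (Suc t) / real (t + 2) ^ 3
    + 2 * (gharm 1 (Suc t) / real (t + 2) ^ 4)"
proof -
  have "recip_conv 3 t / real (t + 2) = (gharm 3 (Suc t) + recip_conv 2 t) / real (t + 2) / real (t + 2)"
    using recip_conv_Suc[of 2 t] by simp
  also have "\<dots> = gharm 3 (Suc t) / real (t + 2) ^ 2 + recip_conv 2 t / real (t + 2) / real (t + 2)"
    by (simp add: add_divide_distrib power2_eq_square)
  finally show ?thesis
    unfolding recip_conv_2 by (simp add: add_divide_distrib power2_eq_square power3_eq_cube power4_eq_xxxx)
qed

text \<open>With $T$ for the second sum, three relations are solved: $\<zeta>(2)^2 = 2S$ from the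
  Cauchy product, $S = T + 2(S - \<zeta>(4))$ from regrouping, and $\<zeta>(2)^2 = 2T + \<zeta>(4)$
  from the product formula.\<close>

lemma euler_sum_3: "(\<lambda>n. harm (Suc n) / real (Suc n) ^ 3) sums (5 / 4 * rzeta 4)"
  and gharm_2_sum: "(\<lambda>n. gharm 2 n / real (Suc n) ^ 2) sums (3 / 4 * rzeta 4)"
proof -
  obtain S where S: "(\<lambda>n. harm (Suc n) / real (Suc n) ^ 3) sums S"
    using summable_euler_sum[of 3] by (auto simp: summable_def)
  have C: "(\<lambda>t. recip_conv 2 t / real (t + 2)) sums S"
    using euler_sum_conv[of 2 S] S by simp
  have Z: "rzeta 2 * rzeta 2 = 2 * S"
    using sums_unique2[OF rzeta_2_squared_conv sums_mult[OF C]] .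
  have A: "(\<lambda>n. gharm 2 n / real (Suc n) ^ 2 + 2 * (gharm 1 n / real (Suc n) ^ 3)) sums S"
    using C unfolding recip_conv_2 by - (rule sums_shift_zero, simp_all add: add_ac)
  have B: "(\<lambda>n. gharm 1 n / real (Suc n) ^ 3) sums (S - rzeta 4)"
    using euler_sum_shift[OF _ S] by simp
  have D: "(\<lambda>n. gharm 2 n / real (Suc n) ^ 2) sums (S - 2 * (S - rzeta 4))"
    using sums_diff[OF A sums_mult[OF B, of 2]] by simp
  have "(\<lambda>n. 2 * (gharm 2 n / real (Suc n) ^ 2) + 1 / real (Suc n) ^ 4) sums (2 * S)"
    using stuffle_sums[of 2 2] unfolding Z by simp
  then have "2 * S = 2 * (S - 2 * (S - rzeta 4)) + rzeta 4"
    by (rule sums_unique2) (intro sums_add sums_mult D rzeta_sums, simp)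
  then have "S = 5 / 4 * rzeta 4" by simp
  with S D show "(\<lambda>n. harm (Suc n) / real (Suc n) ^ 3) sums (5 / 4 * rzeta 4)"
    "(\<lambda>n. gharm 2 n / real (Suc n) ^ 2) sums (3 / 4 * rzeta 4)"
    by simp_all
qed

text \<open>The sums with \<open>gharm 3\<close> and \<open>gharm 2\<close> occur only added
  together, in the combination that \<open>stuffle_sums\<close> evaluates, so neither is needed
  alone.\<close>

lemma euler_sum_4: "(\<lambda>n. harm (Suc n) / real (Suc n) ^ 4) sums (3 * rzeta 5 - rzeta 2 * rzeta 3)"
proof -
  obtain S where S: "(\<lambda>n. harm (Suc n) / real (Suc n) ^ 4) sums S"
    using summable_euler_sum[of 4] by (auto simp: summable_def)
  have C: "(\<lambda>t. recip_conv 3 t / real (t + 2)) sums S"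
    using euler_sum_conv[of 3 S] S by simp
  have A: "(\<lambda>n. gharm 3 n / real (Suc n) ^ 2 + gharm 2 n / real (Suc n) ^ 3 + 2 * (gharm 1 n / real (Suc n) ^ 4)) sums S"
    using C unfolding recip_conv_3 by - (rule sums_shift_zero, simp_all add: add_ac)
  have B: "(\<lambda>n. gharm 1 n / real (Suc n) ^ 4) sums (S - rzeta 5)"
    using euler_sum_shift[OF _ S] by simp
  have D: "(\<lambda>n. gharm 3 n / real (Suc n) ^ 2 + gharm 2 n / real (Suc n) ^ 3) sums (S - 2 * (S - rzeta 5))"
    using sums_diff[OF A sums_mult[OF B, of 2]] by simp
  have "(\<lambda>n. gharm 3 n / real (Suc n) ^ 2 + gharm 2 n / real (Suc n) ^ 3 + 1 / real (Suc n) ^ 5) sums (rzeta 3 * rzeta 2)"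
    using stuffle_sums[of 3 2] by simp
  then have "rzeta 3 * rzeta 2 = S - 2 * (S - rzeta 5) + rzeta 5"
    by (rule sums_unique2) (intro sums_add D rzeta_sums, simp)
  then have "S = 3 * rzeta 5 - rzeta 2 * rzeta 3" by (simp add: mult.commute)
  with S show ?thesis by simp
qed

section \<open>The quadratic Euler sum\<close>

lemma euler_sum_harm_squared: "(\<lambda>n. (harm (Suc n))\<^sup>2 / real (Suc n) ^ 2) sums (17 / 4 * rzeta 4)"
proof -
  obtain Q where Q: "(\<lambda>n. (harm (Suc n))\<^sup>2 / real (Suc n) ^ 2) sums Q"
    using summable_harm_squared by (auto simp: summable_def)
  let ?f = "\<lambda>i j. 1 / (real (Suc i) * real (i + j + 2)) * (harm (Suc j) / real (Suc j))"
  let ?g = "\<lambda>n. (((harm n)\<^sup>2 + gharm 2 n) / 2 + ((harm (Suc n))\<^sup>2 - gharm 2 (Suc n))) / real (Suc n) ^ 2"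
  have A: "(\<lambda>t. \<Sum>i\<le>t. ?f i (t - i)) sums Q"
  proof (rule antidiagonal_sums)
    show "(\<lambda>i. ?f i j) sums (harm (Suc j) / real (Suc j) * (harm (Suc j) / real (Suc j)))" for j
      by (intro sums_mult2 harm_row_sums)
    show "(\<lambda>j. harm (Suc j) / real (Suc j) * (harm (Suc j) / real (Suc j))) sums Q"
      using Q by (simp add: power2_eq_square del: of_nat_Suc)
  qed (auto simp: harm_nonneg)
  have "(\<Sum>i\<le>t. ?f i (t - i)) = ?g (Suc t)" for t
  proof -
    let ?u = "\<lambda>i. harm (Suc i) / real (Suc i)"
    \<comment> \<open>With $s = m + n$, the weight $1/(m s n)$ equals $(1/m + 1/n)/s^2$.\<close>
    have "(\<Sum>i\<le>t. ?f i (t - i)) = (\<Sum>i\<le>t. (?u (t - i) + harm (Suc (t - i)) / real (Suc i)) / real (t + 2) ^ 2)"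
    proof (rule sum.cong[OF refl])
      fix i assume "i \<in> {..t}"
      then have e: "real (t + 2) = real (Suc i) + real (Suc (t - i))" "real (i + (t - i) + 2) = real (Suc i) + real (Suc (t - i))"
        by simp_all
      have "0 < real (Suc i)" "0 < real (Suc (t - i))" by auto
      then show "?f i (t - i) = (?u (t - i) + harm (Suc (t - i)) / real (Suc i)) / real (t + 2) ^ 2"
        unfolding e by (simp add: divide_simps add_nonneg_eq_0_iff del: of_nat_Suc)
           (simp add: algebra_simps power2_eq_square del: of_nat_Suc)
    qed
    also have "\<dots> = ((\<Sum>i\<le>t. ?u i) + (\<Sum>i\<le>t. harm (Suc (t - i)) / real (Suc i))) / real (t + 2) ^ 2"
      by (simp only: sum_divide_distrib[symmetric] sum.distrib sum_atMost_rev[of ?u])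
    also have "\<dots> = ?g (Suc t)"
      unfolding sum_harm_div sum_harm_conv by simp
    finally show ?thesis .
  qed
  \<comment> \<open>\<open>?g 0\<close> vanishes because $H_1^2$ and $H_1^{(2)}$ are both 1.\<close>
  with A have "?g sums Q"
    by - (rule sums_shift_zero, simp_all add: harm_expand gharm_Suc)
  moreover have "?g n = 3 / 2 * ((harm (Suc n))\<^sup>2 / real (Suc n) ^ 2) - harm (Suc n) / real (Suc n) ^ 3
      - 1 / 2 * (gharm 2 n / real (Suc n) ^ 2) - 1 / 2 * (1 / real (Suc n) ^ 4)" for n
  proof -
    have h: "harm n = harm (Suc n) - 1 / real (Suc n)" by (simp add: harm_Suc divide_inverse)
    show ?thesis unfolding h gharm_Suc
      by (simp add: field_simps power2_eq_square power3_eq_cube power4_eq_xxxx del: of_nat_Suc)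
  qed
  ultimately have "(\<lambda>n. 3 / 2 * ((harm (Suc n))\<^sup>2 / real (Suc n) ^ 2) - harm (Suc n) / real (Suc n) ^ 3
      - 1 / 2 * (gharm 2 n / real (Suc n) ^ 2) - 1 / 2 * (1 / real (Suc n) ^ 4)) sums Q"
    by simp
  \<comment> \<open>\<open>Q\<close> returns with factor 3/2 rather than 1, so the equation
    determines it.\<close>
  then have "Q = 3 / 2 * Q - 5 / 4 * rzeta 4 - 1 / 2 * (3 / 4 * rzeta 4) - 1 / 2 * rzeta 4"
    by (rule sums_unique2) (intro sums_diff sums_mult Q euler_sum_3 gharm_2_sum rzeta_sums, simp)
  then have "Q = 17 / 4 * rzeta 4" by simp
  with Q show ?thesis by simp
qed

section \<open>Telescoping decomposition of the summand\<close>

text \<open>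
  Here \<open>h\<close>, \<open>a\<close>, \<open>b\<close>, \<open>c\<close> stand for $H_k$, $1/k$, $1/(k+1)$, $1/(k+2)$. The coefficients result from
  expanding the summand into terms $H_k^d/(k+j)^e$ and lowering the shift $j$ by
  $H_k^d/(k+j)^e = g(k+1)$, where $g(k) = (H_k - 1/k)^d/(k+j-1)^e$.
\<close>
definition harm_telescope :: "real \<Rightarrow> real \<Rightarrow> real \<Rightarrow> real \<Rightarrow> real" where
  "harm_telescope h a b c =
     h^4 * (b/3 - a/6 - c/6)
   + h^3 * (5/6 * b^2 - 1/6 * c^2 - 13/18 * a + 7/9 * b - 1/18 * c)
   + h^2 * (1/2 * b^3 + 1/4 * a^2 + 4/3 * b^2 + 1/12 * c^2 - 73/72 * a + 71/72 * b + 5/18 * c)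
   + h * (1/6 * a^4 + 1/6 * a^3 + 1/2 * b^3 - 1/18 * a^2 + b^2 + 1/12 * c^2 - 11/24 * a + 17/24 * b + 7/36 * c)
   + 1/18 * a^4 - 13/72 * a^3 - 4/9 * a^2"

text \<open>The hypotheses are the partial fractions for $1/k, ..., 1/(k+3)$. Used as rewrite rules
  they remove all mixed products of reciprocals, after which both sides agree term by term.\<close>

lemma harm_product_telescopes:
  fixes a b c d h :: real
  assumes ab: "a * b = a - b" and bc: "b * c = b - c" and cd: "c * d = c - d"
    and ac: "a * c = (a - c) / 2" and bd: "b * d = (b - d) / 2" and ad: "a * d = (a - d) / 3"
  shows "h * (h + b) * (h + b + c) * (h + b + c + d) * (a * b * c * d)
   = (1/4 * (h^2 * a^2) - 1/18 * (h * a^2) + 1/6 * (h * a^3) + 1/6 * (h * a^4) + 1/18 * a^4 - 13/72 * a^3 - 4/9 * a^2)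
     + (harm_telescope (h + b) b c d - harm_telescope h a b c)"
proof -
  \<comment> \<open>The extra factor \<open>z\<close> lets the rules act inside right-nested
    products.\<close>
  have r: "a * (b * z) = (a - b) * z" "b * (c * z) = (b - c) * z" "c * (d * z) = (c - d) * z"
    "a * (c * z) = ((a - c) / 2) * z" "b * (d * z) = ((b - d) / 2) * z" "a * (d * z) = ((a - d) / 3) * z" for z
    using assms by (metis mult.assoc)+
  show ?thesis unfolding harm_telescope_def power4_eq_xxxx power3_eq_cube power2_eq_square
    by (simp add: assms r algebra_simps add_divide_distrib diff_divide_distrib)
qed

text \<open>Each of the five coefficients of powers of \<open>h\<close> is crudely at most
  \<open>4 * a\<close> in absolute value, and every such power is at most
  \<open>h ^ 4\<close>.\<close>

lemma harm_telescope_bound: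
  fixes a b c h :: real
  assumes h: "h \<ge> 1" and abc: "0 \<le> c" "c \<le> b" "b \<le> a" "a \<le> 1"
  shows "\<bar>harm_telescope h a b c\<bar> \<le> 20 * (h ^ 4 * a)"
proof -
  have pow: "0 \<le> y ^ k" "y ^ k \<le> a" if "k \<ge> 1" "0 \<le> y" "y \<le> a" for y :: real and k
    using that abc power_decreasing[of 1 k y] by auto
  have le: "\<bar>h ^ i * P\<bar> \<le> K * (h ^ 4 * a)" if "i \<le> 4" "\<bar>P\<bar> \<le> K * a" for i P K
  proof -
    have "\<bar>h ^ i * P\<bar> = h ^ i * \<bar>P\<bar>"
      using h by (simp add: abs_mult)
    also have "\<dots> \<le> h ^ 4 * (K * a)"
      using that h by (intro mult_mono power_increasing) auto
    finally show ?thesis by (simp add: mult_ac)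
  qed
  have p: "0 \<le> a^2" "a^2 \<le> a" "0 \<le> a^3" "a^3 \<le> a" "0 \<le> a^4" "a^4 \<le> a"
    "0 \<le> b^2" "b^2 \<le> a" "0 \<le> b^3" "b^3 \<le> a" "0 \<le> c^2" "c^2 \<le> a"
    using abc by (auto intro: pow)
  have "\<bar>h ^ 4 * (b/3 - a/6 - c/6)\<bar> \<le> 4 * (h ^ 4 * a)"
    by (rule le, simp, use abc in linarith)
  moreover have "\<bar>h ^ 3 * (5/6 * b^2 - 1/6 * c^2 - 13/18 * a + 7/9 * b - 1/18 * c)\<bar> \<le> 4 * (h ^ 4 * a)"
    by (rule le, simp, use abc p in linarith)
  moreover have "\<bar>h ^ 2 * (1/2 * b^3 + 1/4 * a^2 + 4/3 * b^2 + 1/12 * c^2 - 73/72 * a + 71/72 * b + 5/18 * c)\<bar> \<le> 4 * (h ^ 4 * a)"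
    by (rule le, simp, use abc p in linarith)
  moreover have "\<bar>h ^ 1 * (1/6 * a^4 + 1/6 * a^3 + 1/2 * b^3 - 1/18 * a^2 + b^2 + 1/12 * c^2 - 11/24 * a + 17/24 * b + 7/36 * c)\<bar> \<le> 4 * (h ^ 4 * a)"
    by (rule le, simp, use abc p in linarith)
  moreover have "\<bar>h ^ 0 * (1/18 * a^4 - 13/72 * a^3 - 4/9 * a^2)\<bar> \<le> 4 * (h ^ 4 * a)"
    by (rule le, simp, use abc p in linarith)
  ultimately show ?thesis
    unfolding harm_telescope_def power_one_right power_0 mult_1_left by linarith
qed

section \<open>Evaluation of the series\<close>

lemma harm_product_sums:
  "(\<lambda>n. harm (n + 1) * harm (n + 2) * harm (n + 3) * harm (n + 4) /
      (real (n + 1) * real (n + 2) * real (n + 3) * real (n + 4)))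
    sums (- (4 / 9) * rzeta 2 - 1 / 6 * rzeta 2 * rzeta 3 - 7 / 24 * rzeta 3
          + 191 / 144 * rzeta 4 + 1 / 2 * rzeta 5)"
proof -
  define h a G B where "h n = (harm (Suc n) :: real)" and "a n = 1 / real (Suc n)"
    and "G n = harm_telescope (h n) (a n) (a (Suc n)) (a (Suc (Suc n)))"
    and "B n = 1/4 * (h n ^ 2 * a n ^ 2) - 1/18 * (h n * a n ^ 2) + 1/6 * (h n * a n ^ 3) + 1/6 * (h n * a n ^ 4)
      + 1/18 * a n ^ 4 - 13/72 * a n ^ 3 - 4/9 * a n ^ 2" for n
  have step: "harm (n + 1) * harm (n + 2) * harm (n + 3) * harm (n + 4) /
      (real (n + 1) * real (n + 2) * real (n + 3) * real (n + 4)) = B n + (G (Suc n) - G n)" for n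
  proof -
    have hSuc: "h (Suc m) = h m + a (Suc m)" for m
      by (simp add: h_def a_def harm_Suc[of "Suc m"] divide_inverse)
    have rel: "a m * a (m + k) = (a m - a (m + k)) / real k" if "k > 0" for m k
      using inverse_mult_add[of "real (Suc m)" "real k"] that by (simp add: a_def add_ac)
    have "h n * (h n + a (n+1)) * (h n + a (n+1) + a (n+2)) * (h n + a (n+1) + a (n+2) + a (n+3))
        * (a n * a (n+1) * a (n+2) * a (n+3))
      = B n + (harm_telescope (h n + a (n+1)) (a (n+1)) (a (n+2)) (a (n+3))
               - harm_telescope (h n) (a n) (a (n+1)) (a (n+2)))"
      unfolding B_def
      by (rule harm_product_telescopes)
         (use rel[of 1 n] rel[of 1 "n+1"] rel[of 1 "n+2"] rel[of 2 n] rel[of 2 "n+1"] rel[of 3 n]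
          in \<open>simp_all add: numeral_3_eq_3\<close>)
    also have "\<dots> = B n + (G (Suc n) - G n)"
      by (simp add: G_def hSuc numeral_2_eq_2 numeral_3_eq_3)
    finally have "h n * h (n+1) * h (n+2) * h (n+3) * (a n * a (n+1) * a (n+2) * a (n+3))
      = B n + (G (Suc n) - G n)"
      using hSuc[of n] hSuc[of "n+1"] hSuc[of "n+2"] by (simp add: numeral_2_eq_2 numeral_3_eq_3)
    then show ?thesis
      by (simp add: h_def a_def eval_nat_numeral add_ac)
  qed
  have "G \<longlonglongrightarrow> 0"
  proof (rule Lim_null_comparison)
    show "\<forall>\<^sub>F n in sequentially. norm (G n) \<le> 20 * (harm (Suc n) ^ 4 / real (Suc n))"
    proof (rule always_eventually, rule allI)
      fix n
      have "\<bar>harm_telescope (h n) (a n) (a (Suc n)) (a (Suc (Suc n)))\<bar> \<le> 20 * (h n ^ 4 * a n)"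
        by (rule harm_telescope_bound) (auto simp: h_def a_def harm_Suc_ge_1 frac_le)
      then show "norm (G n) \<le> 20 * (harm (Suc n) ^ 4 / real (Suc n))"
        by (simp add: G_def h_def a_def)
    qed
    show "(\<lambda>n. 20 * (harm (Suc n) ^ 4 / real (Suc n) :: real)) \<longlonglongrightarrow> 0"
      using tendsto_mult_right_zero[OF harm_power4_over_nat_tendsto_0] .
  qed
  then have "(\<lambda>n. G (Suc n) - G n) sums (0 - G 0)"
    by (rule telescope_sums)
  \<comment> \<open>At $k = 1$ the arguments are 1, 1, 1/2, 1/3 and everything cancels, so no
    rational constant enters the result.\<close>
  moreover have "G 0 = 0"
    by (simp add: G_def h_def a_def harm_telescope_def harm_expand power_divide)
  moreover have "B sums (1/4 * (17/4 * rzeta 4) - 1/18 * (2 * rzeta 3) + 1/6 * (5/4 * rzeta 4)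
      + 1/6 * (3 * rzeta 5 - rzeta 2 * rzeta 3) + 1/18 * rzeta 4 - 13/72 * rzeta 3 - 4/9 * rzeta 2)"
  proof -
    have z: "(\<lambda>n. a n ^ p) sums rzeta p" if "p \<ge> 2" for p
      using rzeta_sums[OF that] by (simp add: a_def power_divide)
    have e: "(\<lambda>n. h n ^ 2 * a n ^ 2) sums (17/4 * rzeta 4)" "(\<lambda>n. h n * a n ^ 2) sums (2 * rzeta 3)"
      "(\<lambda>n. h n * a n ^ 3) sums (5/4 * rzeta 4)" "(\<lambda>n. h n * a n ^ 4) sums (3 * rzeta 5 - rzeta 2 * rzeta 3)"
      using euler_sum_harm_squared euler_sum_2 euler_sum_3 euler_sum_4 by (simp_all add: h_def a_def power_divide)
    show ?thesis
      unfolding B_def by (intro sums_add sums_diff sums_mult e z) auto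
  qed
  ultimately have "(\<lambda>n. B n + (G (Suc n) - G n)) sums
     (1/4 * (17/4 * rzeta 4) - 1/18 * (2 * rzeta 3) + 1/6 * (5/4 * rzeta 4)
      + 1/6 * (3 * rzeta 5 - rzeta 2 * rzeta 3) + 1/18 * rzeta 4 - 13/72 * rzeta 3 - 4/9 * rzeta 2 + (0 - 0))"
    by (intro sums_add) auto
  \<comment> \<open>Collecting terms: $17/16 + 5/24 + 1/18 = 191/144$ for $\<zeta>(4)$ and $-1/9 -
    13/72 = -7/24$ for $\<zeta>(3)$.\<close>
  then show ?thesis
    unfolding step by (rule back_subst[where P = "\<lambda>x. _ sums x"]) (simp add: field_simps)
qed

theorem theorem2p6:
  shows "(\<lambda>n. let k = Suc n in
            (harm k * harm (k + 1) * harm (k + 2) * harm (k + 3) :: complex) /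
            (of_nat k * of_nat (k + 1) * of_nat (k + 2) * of_nat (k + 3)))
         sums (- (4 / 9) * zeta 2 - 1 / 6 * zeta 2 * zeta 3 - 7 / 24 * zeta 3
               + 191 / 144 * zeta 4 + 1 / 2 * zeta 5)"
proof -
  have z: "zeta 2 = of_real (rzeta 2)" "zeta 3 = of_real (rzeta 3)" "zeta 4 = of_real (rzeta 4)" "zeta 5 = of_real (rzeta 5)"
    using zeta_of_nat[of 2] zeta_of_nat[of 3] zeta_of_nat[of 4] zeta_of_nat[of 5] by simp_all
  have "(\<lambda>n. complex_of_real (harm (n + 1) * harm (n + 2) * harm (n + 3) * harm (n + 4) /
      (real (n + 1) * real (n + 2) * real (n + 3) * real (n + 4))))
    sums of_real (- (4 / 9) * rzeta 2 - 1 / 6 * rzeta 2 * rzeta 3 - 7 / 24 * rzeta 3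
          + 191 / 144 * rzeta 4 + 1 / 2 * rzeta 5)"
    by (rule sums_of_real[OF harm_product_sums])
  then show ?thesis
    by (simp add: z Let_def of_real_harm eval_nat_numeral)
qed

end
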